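(* Fix an integer $k \geq 3$. Let $f_0(x), f_1(x), \ldots$ be a sequence of polynomials satisfying $$f_n(x) = x \sum_{j=1}^k f_{n-j}(x)$$ for all $n \geq k$. For $n \geq 0$ let $\mathcal{P}_n$ be the property that (i) the coefficient sequence of $f_i$ is non-negative and unimodal for each $0 \leq i \leq n$, and (ii) there is a choice of modes $m_i$ of $f_i$ ($0 \leq i \leq n$) such that the sequence $(m_i)_{i=0}^n$ is barely increasing. If $\mathcal{P}_k$ holds, then $\mathcal{P}_n$ holds for all $n \geq k$.
   Context: A sequence $(a_c)_{c\geq 0}$ is unimodal if there is an index $m$ (a mode) with $a_0 \leq a_1 \leq \cdots \leq a_m \geq a_{m+1} \geq a_{m+2} \geq \cdots$; modes need not be unique. A polynomial is unimodal if its coefficient sequence $(a_c)_{c \geq 0}$ (where $a_c$ is the coefficient of $x^c$) is unimodal, and a mode of the polynomial is a mode of this sequence. A sequence $(m_i)_{i=c}^d$ is barely increasing if $0 \leq m_{i+1}-m_i \leq 1$ for all $c \leq i \leq d-1$. *)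

theory Defs
  imports Complex_Main "HOL-Computational_Algebra.Polynomial"
begin

definition is_mode :: "(nat \<Rightarrow> 'a::linorder) \<Rightarrow> nat \<Rightarrow> bool" where
  "is_mode a m \<longleftrightarrow> (\<forall>c<m. a c \<le> a (Suc c)) \<and> (\<forall>c\<ge>m. a (Suc c) \<le> a c)"

definition unimodal :: "(nat \<Rightarrow> 'a::linorder) \<Rightarrow> bool" where
  "unimodal a \<longleftrightarrow> (\<exists>m. is_mode a m)"

text \<open>The difference is taken in the integers, where it does not truncate.\<close>

definition barely_increasing :: "(nat \<Rightarrow> nat) \<Rightarrow> nat \<Rightarrow> nat \<Rightarrow> bool" where
  "barely_increasing m c d \<longleftrightarrow>
     (\<forall>i\<in>{c..<d}. 0 \<le> int (m (Suc i)) - int (m i) \<and> int (m (Suc i)) - int (m i) \<le> 1)"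

definition property_P :: "(nat \<Rightarrow> real poly) \<Rightarrow> nat \<Rightarrow> bool" where
  "property_P f n \<longleftrightarrow>
     (\<forall>i\<le>n. (\<forall>c. 0 \<le> coeff (f i) c) \<and> unimodal (coeff (f i))) \<and>
     (\<exists>m. (\<forall>i\<le>n. is_mode (coeff (f i)) (m i)) \<and> barely_increasing m 0 n)"

end

theory Submission
  imports Defs
begin

text \<open>
  With \<open>a\<^sub>n\<close> the coefficient sequence of \<open>f\<^sub>n\<close>, the recurrence reads
  \<open>a\<^sub>n(c+1) = \<Sum>\<^sub>j a\<^sub>n\<^sub>-\<^sub>j(c)\<close>. Subtracting two consecutive instances gives
  \<open>a\<^sub>n\<^sub>+\<^sub>1(c+1) + a\<^sub>n\<^sub>-\<^sub>k(c) = a\<^sub>n(c+1) + a\<^sub>n(c)\<close>. Let \<open>m\<^sub>i\<close> be the modes. By the summed form,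
  \<open>a\<^sub>n\<^sub>+\<^sub>1\<close> ascends up to index \<open>m\<^sub>n\<^sub>+\<^sub>1\<^sub>-\<^sub>k + 1\<close> and descends from index \<open>m\<^sub>n + 1\<close> on. Between
  \<open>m\<^sub>n\<^sub>+\<^sub>1\<^sub>-\<^sub>k + 1\<close> and \<open>m\<^sub>n\<close> the three-term form shows that it ascends, because there \<open>a\<^sub>n\<close>
  still ascends while \<open>a\<^sub>n\<^sub>-\<^sub>k\<close>, which enters negatively, already descends. So \<open>m\<^sub>n\<close> or
  \<open>m\<^sub>n + 1\<close> is a mode of \<open>a\<^sub>n\<^sub>+\<^sub>1\<close>.
\<close>

lemma is_mode_ascend: "is_mode a m \<Longrightarrow> c < m \<Longrightarrow> a c \<le> a (Suc c)"
  by (simp add: is_mode_def)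

lemma is_mode_descend: "is_mode a m \<Longrightarrow> m \<le> c \<Longrightarrow> a (Suc c) \<le> a c"
  by (simp add: is_mode_def)

text \<open>Only the comparison of the entries at \<open>m\<close> and \<open>Suc m\<close> is left
  open; its outcome decides which of the two is a mode.\<close>

lemma is_mode_cases:
  assumes "\<And>c. c < m \<Longrightarrow> a c \<le> a (Suc c)"
    and "\<And>c. Suc m \<le> c \<Longrightarrow> a (Suc c) \<le> a c"
  shows "is_mode a m \<or> is_mode a (Suc m)"
proof (cases "a m \<le> a (Suc m)")
  case True
  then have "is_mode a (Suc m)"
    using assms by (auto simp: is_mode_def less_Suc_eq)
  then show ?thesis ..
next
  case False
  then have "a (Suc c) \<le> a c" if "m \<le> c" for c
    using assms(2)[of c] that by (cases "c = m") auto
  then show ?thesis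
    using assms(1) by (auto simp: is_mode_def)
qed

lemma barely_increasing_Suc:
  assumes "barely_increasing m c d" "m (Suc d) = m d \<or> m (Suc d) = Suc (m d)"
  shows "barely_increasing m c (Suc d)"
  using assms by (auto simp: barely_increasing_def less_Suc_eq)

lemma barely_increasing_mono:
  assumes "barely_increasing m c d" "c \<le> i" "i \<le> j" "j \<le> d"
  shows "m i \<le> m j"
  using assms(3,4)
proof (induction rule: dec_induct)
  case (step j)
  have "m j \<le> m (Suc j)"
    using assms(1,2) step by (force simp: barely_increasing_def)
  with step show ?case by simp
qed simp

lemma property_P_Suc:
  fixes f :: "nat \<Rightarrow> real poly"
  assumes "1 \<le> k" "k \<le> n"
    and rec: "\<And>n. n \<ge> k \<Longrightarrow> f n = [:0, 1:] * (\<Sum>j=1..k. f (n - j))"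
    and P: "property_P f n"
  shows "property_P f (Suc n)"
proof -
  define a where "a i = coeff (f i)" for i
  have a_0: "a (Suc n) 0 = 0"
    using rec[of "Suc n"] \<open>k \<le> n\<close> by (simp add: a_def)
  have a_Suc: "a i (Suc c) = (\<Sum>j=1..k. a (i - j) c)" if "k \<le> i" for i c
    using rec[OF that] by (simp add: a_def coeff_sum)
  have three_term: "a (Suc n) (Suc c) + a (n - k) c = a n (Suc c) + a n c" for c
  proof -
    \<comment> \<open>The sum over the \<open>k + 1\<close> indices from \<open>n - k\<close> to
      \<open>n\<close> is split at its oldest term, then at its newest; what remains is an instance
      of the recurrence each time.\<close>
    have "a (Suc n) (Suc c) + a (n - k) c = (\<Sum>j=1..Suc k. a (Suc n - j) c)"
      using a_Suc[of "Suc n" c] \<open>k \<le> n\<close> by simp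
    also have "\<dots> = a n c + (\<Sum>j=1..k. a (n - j) c)"
      unfolding One_nat_def sum.atLeast_Suc_atMost_Suc_shift
      by (simp add: sum.atLeast_Suc_atMost)
    finally show ?thesis
      using a_Suc[of n c] \<open>k \<le> n\<close> by simp
  qed
  obtain m where mode: "\<And>i. i \<le> n \<Longrightarrow> is_mode (a i) (m i)"
    and barely: "barely_increasing m 0 n"
    using P by (auto simp: property_P_def a_def)
  have nonneg: "0 \<le> a i c" if "i \<le> n" for i c
    using P that by (auto simp: property_P_def a_def)
  have nonneg_Suc: "0 \<le> a (Suc n) c" for c
  proof (cases c)
    case (Suc d)
    then show ?thesis
      using a_Suc[of "Suc n" d] \<open>k \<le> n\<close> by (auto intro!: sum_nonneg nonneg)
  qed (simp add: a_0)
  note mono = barely_increasing_mono[OF barely le0]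

  have "a (Suc n) c \<le> a (Suc n) (Suc c)" if "c < m n" for c
  proof (cases c)
    case 0
    then show ?thesis using a_0 nonneg_Suc by simp
  next
    case (Suc d)
    show ?thesis
    \<comment> \<open>The oldest summand of \<open>a (Suc n)\<close> has the least of the chosen
      modes, so below it all summands ascend.\<close>
    proof (cases "d < m (Suc n - k)")
      case True
      have "a (Suc n - j) d \<le> a (Suc n - j) (Suc d)" if "j \<in> {1..k}" for j
      proof (rule is_mode_ascend[OF mode])
        show "d < m (Suc n - j)"
          using True mono[of "Suc n - k" "Suc n - j"] that by fastforce
      qed (use that in auto)
      then show ?thesis
        using \<open>k \<le> n\<close> by (auto simp: Suc a_Suc intro!: sum_mono)
    next
      case False
      then have "m (n - k) \<le> d"
        using mono[of "n - k" "Suc n - k"] \<open>1 \<le> k\<close> by fastforce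
      then have "a (n - k) (Suc d) \<le> a (n - k) d"
        by (intro is_mode_descend[OF mode]) auto
      \<comment> \<open>Subtracting the two instances of \<open>three_term\<close> compares
        \<open>a n\<close> two indices apart; \<open>Suc d < m n\<close> leaves room for both
        ascents.\<close>
      moreover have "a n d \<le> a n (Suc d)" "a n (Suc d) \<le> a n (Suc (Suc d))"
        using that Suc by (auto intro!: is_mode_ascend[OF mode])
      ultimately show ?thesis
        using three_term[of d] three_term[of "Suc d"] by (simp add: Suc)
    qed
  qed
  moreover have "a (Suc n) (Suc c) \<le> a (Suc n) c" if "Suc (m n) \<le> c" for c
  proof -
    obtain d where d: "c = Suc d" "m n \<le> d"
      using \<open>Suc (m n) \<le> c\<close> by (cases c) auto
    have "a (Suc n - j) (Suc d) \<le> a (Suc n - j) d" if "j \<in> {1..k}" for j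
    proof (rule is_mode_descend[OF mode])
      show "m (Suc n - j) \<le> d"
        using d mono[of "Suc n - j" n] that by fastforce
    qed (use that in auto)
    then show ?thesis
      using \<open>k \<le> n\<close> by (auto simp: d a_Suc intro!: sum_mono)
  qed
  ultimately obtain M where M: "M = m n \<or> M = Suc (m n)" "is_mode (a (Suc n)) M"
    using is_mode_cases[of "m n" "a (Suc n)"] by blast
  \<comment> \<open>The earlier modes are kept, so only the last increment is new.\<close>
  let ?m = "m(Suc n := M)"
  have "barely_increasing ?m 0 n"
    using barely by (auto simp: barely_increasing_def)
  then have "barely_increasing ?m 0 (Suc n)"
    using M by (intro barely_increasing_Suc) auto
  moreover have "is_mode (a i) (?m i)" if "i \<le> Suc n" for i
    using that M mode by (auto simp: le_Suc_eq)
  moreover have "0 \<le> a i c" if "i \<le> Suc n" for i c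
    using that nonneg nonneg_Suc by (auto simp: le_Suc_eq)
  ultimately show ?thesis
    unfolding property_P_def unimodal_def a_def by blast
qed

theorem theorem6:
  fixes k :: nat and f :: "nat \<Rightarrow> real poly"
  assumes "k \<ge> 3"
    and "\<And>n. n \<ge> k \<Longrightarrow> f n = [:0, 1:] * (\<Sum>j=1..k. f (n - j))"
    and "property_P f k"
  shows "\<forall>n\<ge>k. property_P f n"
proof (intro allI impI)
  fix n
  assume "k \<le> n"
  then show "property_P f n"
  proof (induction rule: dec_induct)
    case base
    show ?case by (fact assms(3))
  next
    case (step n)
    show ?case
      using property_P_Suc[OF _ step(1) assms(2) step(3)] \<open>k \<ge> 3\<close> by simp
  qed
qed

end
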